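(* Let $P$ be a normal logic program such that $\mathrm{GL}_P : I_P \to I_P$ is continuous with respect to the topology $Q$, and let $I \in I_P$ be such that the sequence of iterates $(\mathrm{GL}_P^m(I))_{m\in\mathbb{N}}$ converges in $Q$ to some $M \in I_P$. Then $M$ is a stable model of $P$.
   Context: A normal logic program $P$ is a finite set of (universally quantified) clauses $A \leftarrow L_1,\ldots,L_n$ with $n \ge 0$, where $A$ (the head) is an atom and the $L_i$ (the body literals) are atoms or negated atoms of a first-order language $\mathcal{L}$ (function symbols allowed). $B_P$ is the set of all ground atoms over $\mathcal{L}$ and $\mathrm{ground}(P)$ is the set of all ground instances over $\mathcal{L}$ of clauses of $P$. $I_P$ is the power set of $B_P$ (the set of interpretations), identified with the set of all functions $B_P \to \{\mathbf{t},\mathbf{f}\}$, so $I(A)=\mathbf{t}$ iff $A \in I$. A program without negation is called definite. For a (possibly infinite) ground definite program $R$, $T_R(I)$ is the set of all $A \in B_P$ for which there is a clause $A \leftarrow A_1,\ldots,A_n$ in $R$ with $A_1,\ldots,A_n \in I$; put $T_R{\uparrow}0=\emptyset$, $T_R{\uparrow}(n+1)=T_R(T_R{\uparrow}n)$, and $\mathrm{fix}(T_R)=\bigcup_{n\in\mathbb{N}} T_R{\uparrow}n$, which is the least fixed point of $T_R$. For $I \in I_P$, the Gelfond-Lifschitz transformation $P/I$ is the definite program consisting of exactly those clauses $A \leftarrow A_1,\ldots,A_n$ for which there is a clause $A \leftarrow A_1,\ldots,A_n,\neg B_1,\ldots,\neg B_m$ in $\mathrm{ground}(P)$ with $B_1,\ldots,B_m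 \notin I$. The Gelfond-Lifschitz operator is $\mathrm{GL}_P : I_P \to I_P$, $\mathrm{GL}_P(I) = \mathrm{fix}(T_{P/I})$. A stable model of $P$ is a fixed point of $\mathrm{GL}_P$. $\mathrm{GL}_P^m$ denotes the $m$-fold composition of $\mathrm{GL}_P$ with itself. The topology $Q$ on $I_P$ is the product topology on $\{\mathbf{t},\mathbf{f}\}^{B_P}$, where $\{\mathbf{t},\mathbf{f}\}$ is discrete. *)

theory Defs
  imports "HOL-Analysis.Analysis"
begin

datatype ('f, vars_trm: 'v) trm = Var 'v | Fun 'f "('f, 'v) trm list"

datatype ('p, 'f, vars_atom: 'v) atom = Atom 'p "('f, 'v) trm list"

datatype 'a literal = Pos 'a | Neg 'a

datatype (atoms: 'a) clause = Clause (head: 'a) (body: "'a literal list")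

text \<open>A first-order language is given by its function and predicate symbols, each with its
  arity; constants are function symbols of arity 0. Variables are the elements of the type
  parameter of terms.\<close>

record ('f, 'p) language =
  fun_symbols :: "('f \<times> nat) set"
  pred_symbols :: "('p \<times> nat) set"

primrec is_term :: "('f, 'p) language \<Rightarrow> ('f, 'v) trm \<Rightarrow> bool" where
  "is_term L (Var x) \<longleftrightarrow> True"
| "is_term L (Fun f ts) \<longleftrightarrow> (f, length ts) \<in> fun_symbols L \<and> list_all (is_term L) ts"

primrec is_atom :: "('f, 'p) language \<Rightarrow> ('p, 'f, 'v) atom \<Rightarrow> bool" where
  "is_atom L (Atom p ts) \<longleftrightarrow> (p, length ts) \<in> pred_symbols L \<and> list_all (is_term L) ts"

definition normal_program ::
  "('f, 'p) language \<Rightarrow> ('p, 'f, 'v) atom clause set \<Rightarrow> bool" where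
  "normal_program L P \<longleftrightarrow> finite P \<and> (\<forall>C\<in>P. \<forall>A\<in>atoms C. is_atom L A)"

primrec subst_trm :: "('v \<Rightarrow> ('f, 'v) trm) \<Rightarrow> ('f, 'v) trm \<Rightarrow> ('f, 'v) trm" where
  "subst_trm \<sigma> (Var x) = \<sigma> x"
| "subst_trm \<sigma> (Fun f ts) = Fun f (map (subst_trm \<sigma>) ts)"

primrec subst_atom ::
  "('v \<Rightarrow> ('f, 'v) trm) \<Rightarrow> ('p, 'f, 'v) atom \<Rightarrow> ('p, 'f, 'v) atom" where
  "subst_atom \<sigma> (Atom p ts) = Atom p (map (subst_trm \<sigma>) ts)"

definition base :: "('f, 'p) language \<Rightarrow> ('p, 'f, 'v) atom set" where
  "base L = {A. is_atom L A \<and> vars_atom A = {}}"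

text \<open>Only the instance is required to be ground over the language, not every value of the
  substitution: a variable-free clause is a ground instance of itself even if the language has
  no constants.\<close>

definition ground ::
  "('f, 'p) language \<Rightarrow> ('p, 'f, 'v) atom clause set \<Rightarrow> ('p, 'f, 'v) atom clause set" where
  "ground L P =
     {D. (\<exists>C\<in>P. \<exists>\<sigma>. D = map_clause (subst_atom \<sigma>) C) \<and> atoms D \<subseteq> base L}"

definition interpretations :: "('f, 'p) language \<Rightarrow> ('p, 'f, 'v) atom set set" where
  "interpretations L = Pow (base L)"

definition T_op ::
  "('f, 'p) language \<Rightarrow> ('p, 'f, 'v) atom clause set \<Rightarrow>
   ('p, 'f, 'v) atom set \<Rightarrow> ('p, 'f, 'v) atom set" where
  "T_op L R I = {A \<in> base L. \<exists>As. Clause A (map Pos As) \<in> R \<and> set As \<subseteq> I}"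

definition fix_T ::
  "('f, 'p) language \<Rightarrow> ('p, 'f, 'v) atom clause set \<Rightarrow> ('p, 'f, 'v) atom set" where
  "fix_T L R = (\<Union>n. (T_op L R ^^ n) {})"

text \<open>Positive and negative literals may be interleaved in the body of a clause; the positive
  ones are kept in their order of occurrence.\<close>

definition pos_atoms :: "'a literal list \<Rightarrow> 'a list" where
  "pos_atoms Ls = concat (map (\<lambda>l. case l of Pos A \<Rightarrow> [A] | Neg B \<Rightarrow> []) Ls)"

definition GL_transform ::
  "('f, 'p) language \<Rightarrow> ('p, 'f, 'v) atom clause set \<Rightarrow> ('p, 'f, 'v) atom set \<Rightarrow>
   ('p, 'f, 'v) atom clause set" where
  "GL_transform L P I =
     {Clause (head C) (map Pos (pos_atoms (body C))) | C.
        C \<in> ground L P \<and> (\<forall>B. Neg B \<in> set (body C) \<longrightarrow> B \<notin> I)}"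

definition GL ::
  "('f, 'p) language \<Rightarrow> ('p, 'f, 'v) atom clause set \<Rightarrow>
   ('p, 'f, 'v) atom set \<Rightarrow> ('p, 'f, 'v) atom set" where
  "GL L P I = fix_T L (GL_transform L P I)"

definition stable_model ::
  "('f, 'p) language \<Rightarrow> ('p, 'f, 'v) atom clause set \<Rightarrow> ('p, 'f, 'v) atom set \<Rightarrow> bool" where
  "stable_model L P M \<longleftrightarrow> M \<in> interpretations L \<and> GL L P M = M"

text \<open>The product topology on functions from the base to the discrete two-point space,
  transported to sets of ground atoms along the identification of a set with its
  characteristic function.\<close>

definition Q_topology :: "('f, 'p) language \<Rightarrow> ('p, 'f, 'v) atom set topology" where
  "Q_topology L =
     pullback_topology (interpretations L) (\<lambda>I. \<lambda>A\<in>base L. A \<in> I)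
       (product_topology (\<lambda>_. discrete_topology (UNIV :: bool set)) (base L))"

lemma topspace_Q_topology: "topspace (Q_topology L) = interpretations L"
  by (auto simp: Q_topology_def topspace_pullback_topology)

lemma GL_in_interpretations: "GL L P I \<in> interpretations L"
proof -
  have "(T_op L R ^^ n) {} \<subseteq> base L" for R n
    by (cases n) (auto simp: T_op_def)
  then show ?thesis
    by (auto simp: GL_def fix_T_def interpretations_def)
qed

end

theory Submission imports Defs begin

text \<open>The iterates shifted by one have two limits: \<open>GL L P M\<close>, by continuity of
  the operator at work on the convergent iterates, and \<open>M\<close>, as a tail of the original
  sequence. Limits are unique by \<open>Hausdorff_space_Q_topology\<close>, so \<open>M\<close> is a
  fixed point.\<close>

text \<open>Taking characteristic functions is a continuous injection into a product of discrete
  spaces, and being Hausdorff pulls back along such a map.\<close>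

lemma Hausdorff_space_Q_topology:
  fixes L :: "('f, 'p) language"
  shows "Hausdorff_space (Q_topology L :: ('p, 'f, 'v) atom set topology)"
proof -
  define X where
    "X = product_topology (\<lambda>_. discrete_topology (UNIV :: bool set)) (base L :: ('p, 'f, 'v) atom set)"
  define char where "char = (\<lambda>I. \<lambda>A\<in>(base L :: ('p, 'f, 'v) atom set). A \<in> I)"
  \<comment> \<open>Composing with \<open>id\<close> gives the shape that
    \<open>continuous_map_pullback\<close> concludes.\<close>
  have "continuous_map (Q_topology L) X (id \<circ> char)"
    unfolding Q_topology_def X_def char_def
    by (intro continuous_map_pullback continuous_map_id)
  then have "continuous_map (Q_topology L) X char"
    by simp
  \<comment> \<open>Interpretations lie inside \<open>base L\<close>, so restricting to it loses
    nothing.\<close>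
  moreover have "inj_on char (topspace (Q_topology L))"
    unfolding topspace_Q_topology interpretations_def char_def
    by (rule inj_onI) (auto simp: fun_eq_iff restrict_def split: if_splits)
  moreover have "Hausdorff_space X"
    by (simp add: X_def Hausdorff_space_product_topology)
  ultimately show ?thesis
    using Hausdorff_space_injective_preimage by blast
qed

theorem theorem5:
  fixes L :: "('f, 'p) language"
    and P :: "('p, 'f, 'v) atom clause set"
    and I M :: "('p, 'f, 'v) atom set"
  assumes "normal_program L P"
    and "continuous_map (Q_topology L) (Q_topology L) (GL L P)"
    and "I \<in> interpretations L"
    and "M \<in> interpretations L"
    and "limitin (Q_topology L) (\<lambda>m. (GL L P ^^ m) I) M sequentially"
  shows "stable_model L P M"
proof -
  \<comment> \<open>Applying the operator to the \<open>m\<close>-th iterate gives iterate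
    \<open>Suc m\<close>.\<close>
  have "limitin (Q_topology L) (\<lambda>m. (GL L P ^^ Suc m) I) (GL L P M) sequentially"
    using continuous_map_limit[OF assms(2,5)] by (simp add: o_def)
  moreover have "limitin (Q_topology L) (\<lambda>m. (GL L P ^^ Suc m) I) M sequentially"
    using limitin_sequentially_offset[OF assms(5), of 1] by simp
  ultimately have "GL L P M = M"
    using limitin_Hausdorff_unique[OF _ _ trivial_limit_sequentially Hausdorff_space_Q_topology]
    by blast
  then show ?thesis
    using assms(4) by (simp add: stable_model_def)
qed

end
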